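(* Suppose the weights $\rho(a,x)$ and $w(y)$ are known exactly, and let $\mu(A,X):=\mathbb E[Y\mid X,A]$. Let $\hat\mu:\mathcal A\times\mathcal X\to\mathbb R$ be the outcome model (an estimate of $\mu$, regarded as a fixed function), and let $$\hat\theta_{\mathrm{DR}}=\frac1n\sum_{i=1}^n\rho(a_i,x_i)\,(y_i-\hat\mu(a_i,x_i))+\frac1n\sum_{i=1}^n\sum_{a'\in\mathcal A}\hat\mu(a',x_i)\,\pi^*(a'\mid x_i),\qquad \hat\theta_{\mathrm{MR}}=\frac1n\sum_{i=1}^n w(y_i)\,y_i .$$ Then $$\mathrm{Var}_{\pi^b}[\hat\theta_{\mathrm{DR}}]-\mathrm{Var}_{\pi^b}[\hat\theta_{\mathrm{MR}}]\ \ge\ \frac1n\,\mathbb E_{\pi^b}\Big[\mathrm{Var}_{\pi^b}[\rho(A,X)\,Y\mid Y]-\mathrm{Var}_{\pi^b}[\rho(A,X)\,\mu(A,X)\mid X]\Big].$$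
   Context: Contextual bandit setting. $X\in\mathcal X$ is a context, $A\in\mathcal A$ an action ($\mathcal A$ discrete in the sum above), $Y\in\mathcal Y\subseteq\mathbb R$ a scalar outcome; $p(x)$ is the density of contexts and $p(y\mid x,a)$ the conditional density of the outcome (densities with respect to fixed reference measures). For a policy $\pi(a\mid x)$ the joint density of $(X,A,Y)$ is $p_\pi(x,a,y)=p(y\mid x,a)\,\pi(a\mid x)\,p(x)$, with $Y$-marginal $p_\pi(y)=\int p_\pi(x,a,y)\,da\,dx$; $\mathbb E_\pi$, $\mathrm{Var}_\pi$ denote expectation and variance under $p_\pi$. There is a behaviour policy $\pi^b$ and a target policy $\pi^*$; the data $(x_i,a_i,y_i)_{i=1}^n$ are i.i.d. from $p_{\pi^b}(x,a,y)$, and the variance of estimators is over this data. Define $\rho(a,x)=\pi^*(a\mid x)/\pi^b(a\mid x)$ and $w(y)=p_{\pi^*}(y)/p_{\pi^b}(y)$. Standing assumption (support): for all $x\in\mathcal X,a\in\mathcal A$, $\pi^*(a\mid x)>0\implies\pi^b(a\mid x)>0$. All expectations and variances appearing are implicitly assumed to exist and be finite. *)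

theory Defs
  imports "HOL-Probability.Probability"
begin

text \<open>
  Contexts live in the space of the reference measure \<open>MX\<close>, actions in a countable set \<open>A\<close> with
  counting measure, outcomes in a set \<open>S\<close> of reals with reference measure \<open>MY\<close>.  A sample is a
  triple \<open>(x, a, y)\<close>.  The argument order of densities follows the notation: \<open>pY y x a\<close> is
  \<open>p(y | x, a)\<close>, \<open>\<pi> a x\<close> is \<open>\<pi>(a | x)\<close>.
\<close>

abbreviation ctx :: "'x \<times> 'a \<times> real \<Rightarrow> 'x" where
  "ctx z \<equiv> fst z"

abbreviation act :: "'x \<times> 'a \<times> real \<Rightarrow> 'a" where
  "act z \<equiv> fst (snd z)"

abbreviation outc :: "'x \<times> 'a \<times> real \<Rightarrow> real" where
  "outc z \<equiv> snd (snd z)"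

definition ref_measure :: "'x measure \<Rightarrow> 'a set \<Rightarrow> real measure \<Rightarrow> ('x \<times> 'a \<times> real) measure" where
  "ref_measure MX A MY = MX \<Otimes>\<^sub>M (count_space A \<Otimes>\<^sub>M MY)"

locale contextual_bandit =
  fixes MX :: "'x measure" and A :: "'a set" and S :: "real set" and MY :: "real measure"
    and pX :: "'x \<Rightarrow> real" and pY :: "real \<Rightarrow> 'x \<Rightarrow> 'a \<Rightarrow> real"
  assumes sigma_finite_MX: "sigma_finite_measure MX"
    and countable_A: "countable A"
    and sigma_finite_MY: "sigma_finite_measure MY"
    and sets_MY: "sets MY = sets (restrict_space borel S)"
    and pX_measurable: "pX \<in> borel_measurable MX"
    and pX_nonneg: "\<And>x. x \<in> space MX \<Longrightarrow> 0 \<le> pX x"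
    and pX_density: "(\<integral>\<^sup>+ x. ennreal (pX x) \<partial>MX) = 1"
    and pY_measurable: "(\<lambda>z. pY (outc z) (ctx z) (act z)) \<in> borel_measurable (ref_measure MX A MY)"
    and pY_nonneg: "\<And>x a y. x \<in> space MX \<Longrightarrow> a \<in> A \<Longrightarrow> y \<in> S \<Longrightarrow> 0 \<le> pY y x a"
    and pY_density: "\<And>x a. x \<in> space MX \<Longrightarrow> a \<in> A \<Longrightarrow> (\<integral>\<^sup>+ y. ennreal (pY y x a) \<partial>MY) = 1"

definition policy :: "'x measure \<Rightarrow> 'a set \<Rightarrow> ('a \<Rightarrow> 'x \<Rightarrow> real) \<Rightarrow> bool" where
  "policy MX A \<pi> \<longleftrightarrow>
     (\<lambda>(x, a). \<pi> a x) \<in> borel_measurable (MX \<Otimes>\<^sub>M count_space A) \<and>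
     (\<forall>x\<in>space MX. (\<forall>a\<in>A. 0 \<le> \<pi> a x) \<and> ((\<lambda>a. \<pi> a x) has_sum 1) A)"

definition joint_density ::
  "('x \<Rightarrow> real) \<Rightarrow> (real \<Rightarrow> 'x \<Rightarrow> 'a \<Rightarrow> real) \<Rightarrow> ('a \<Rightarrow> 'x \<Rightarrow> real) \<Rightarrow> 'x \<times> 'a \<times> real \<Rightarrow> real" where
  "joint_density pX pY \<pi> = (\<lambda>(x, a, y). pY y x a * \<pi> a x * pX x)"

definition joint_law ::
  "'x measure \<Rightarrow> 'a set \<Rightarrow> real measure \<Rightarrow> ('x \<Rightarrow> real) \<Rightarrow> (real \<Rightarrow> 'x \<Rightarrow> 'a \<Rightarrow> real) \<Rightarrow>
   ('a \<Rightarrow> 'x \<Rightarrow> real) \<Rightarrow> ('x \<times> 'a \<times> real) measure" where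
  "joint_law MX A MY pX pY \<pi> =
     density (ref_measure MX A MY) (\<lambda>z. ennreal (joint_density pX pY \<pi> z))"

definition outcome_density ::
  "'x measure \<Rightarrow> 'a set \<Rightarrow> ('x \<Rightarrow> real) \<Rightarrow> (real \<Rightarrow> 'x \<Rightarrow> 'a \<Rightarrow> real) \<Rightarrow>
   ('a \<Rightarrow> 'x \<Rightarrow> real) \<Rightarrow> real \<Rightarrow> real" where
  "outcome_density MX A pX pY \<pi> y =
     (\<integral>(x, a). joint_density pX pY \<pi> (x, a, y) \<partial>(MX \<Otimes>\<^sub>M count_space A))"

definition rho :: "('a \<Rightarrow> 'x \<Rightarrow> real) \<Rightarrow> ('a \<Rightarrow> 'x \<Rightarrow> real) \<Rightarrow> 'a \<Rightarrow> 'x \<Rightarrow> real" where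
  "rho \<pi>s \<pi>b a x = \<pi>s a x / \<pi>b a x"

definition marginal_ratio ::
  "'x measure \<Rightarrow> 'a set \<Rightarrow> ('x \<Rightarrow> real) \<Rightarrow> (real \<Rightarrow> 'x \<Rightarrow> 'a \<Rightarrow> real) \<Rightarrow>
   ('a \<Rightarrow> 'x \<Rightarrow> real) \<Rightarrow> ('a \<Rightarrow> 'x \<Rightarrow> real) \<Rightarrow> real \<Rightarrow> real" where
  "marginal_ratio MX A pX pY \<pi>s \<pi>b y =
     outcome_density MX A pX pY \<pi>s y / outcome_density MX A pX pY \<pi>b y"

text \<open>
  Conditional expectation and variance under \<open>P\<close> of \<open>f\<close> given a random element \<open>V\<close> with values
  in \<open>N\<close>, i.e.\ given the sigma-algebra generated by \<open>V\<close>; as functions on the sample space,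
  determined up to null sets.
\<close>

definition cond_expect :: "'z measure \<Rightarrow> 'v measure \<Rightarrow> ('z \<Rightarrow> 'v) \<Rightarrow> ('z \<Rightarrow> real) \<Rightarrow> 'z \<Rightarrow> real" where
  "cond_expect P N V f = real_cond_exp P (vimage_algebra (space P) V N) f"

definition cond_var :: "'z measure \<Rightarrow> 'v measure \<Rightarrow> ('z \<Rightarrow> 'v) \<Rightarrow> ('z \<Rightarrow> real) \<Rightarrow> 'z \<Rightarrow> real" where
  "cond_var P N V f = cond_expect P N V (\<lambda>z. (f z - cond_expect P N V f z)\<^sup>2)"

text \<open>\<open>\<mu>(A, X) = E[Y | X, A]\<close>, as a random variable on the space of samples.\<close>

definition outcome_mean ::
  "'x measure \<Rightarrow> 'a set \<Rightarrow> ('x \<times> 'a \<times> real) measure \<Rightarrow> 'x \<times> 'a \<times> real \<Rightarrow> real" where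
  "outcome_mean MX A P = cond_expect P (MX \<Otimes>\<^sub>M count_space A) (\<lambda>z. (ctx z, act z)) outc"

definition theta_DR ::
  "nat \<Rightarrow> 'a set \<Rightarrow> ('a \<Rightarrow> 'x \<Rightarrow> real) \<Rightarrow> ('a \<Rightarrow> 'x \<Rightarrow> real) \<Rightarrow> ('a \<Rightarrow> 'x \<Rightarrow> real) \<Rightarrow>
   (nat \<Rightarrow> 'x \<times> 'a \<times> real) \<Rightarrow> real" where
  "theta_DR n A \<pi>s \<pi>b \<mu>hat d =
     1 / real n * (\<Sum>i<n. rho \<pi>s \<pi>b (act (d i)) (ctx (d i)) *
                          (outc (d i) - \<mu>hat (act (d i)) (ctx (d i)))) +
     1 / real n * (\<Sum>i<n. \<Sum>\<^sub>\<infinity>a'\<in>A. \<mu>hat a' (ctx (d i)) * \<pi>s a' (ctx (d i)))"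

definition theta_MR :: "nat \<Rightarrow> (real \<Rightarrow> real) \<Rightarrow> (nat \<Rightarrow> 'x \<times> 'a \<times> real) \<Rightarrow> real" where
  "theta_MR n w d = 1 / real n * (\<Sum>i<n. w (outc (d i)) * outc (d i))"

end

theory Submission
  imports Defs
begin

text \<open>
  Write \<open>U = \<rho> Y\<close> and \<open>D = \<rho> \<mu>hat - h(X)\<close> with \<open>h(x) = \<Sum>\<^sub>a \<mu>hat(a, x) \<pi>s(a | x)\<close>, so that
  the two estimators are sample means of \<open>U - D\<close> and of \<open>w(Y) Y\<close>.  By the support condition
  \<open>E[D | X] = 0\<close>, and \<open>D\<close> is a function of \<open>(X, A)\<close>; projecting first onto \<open>(X, A)\<close>, where \<open>U\<close>
  becomes \<open>\<rho> \<mu>\<close>, and then onto \<open>X\<close>, Pythagoras gives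
  \<open>Var[U - D] \<ge> Var[U] - E[Var[\<rho> \<mu> | X]]\<close>.  On the other hand \<open>w(Y) = E[\<rho> | Y]\<close>, so
  \<open>w(Y) Y = E[U | Y]\<close> and \<open>Var[w(Y) Y] = Var[U] - E[Var[U | Y]]\<close>.  Subtract the two.
\<close>

text \<open>The obstacle is integrability. Finite second moments are given only for
  \<open>\<rho> Y\<close> and for the whole doubly robust estimator, while the projections need
  \<open>D\<close> itself in L2. Independence bridges the gap: if a sum of independent variables is
  square integrable, so is each summand. Hence \<open>U - D\<close> is in L2, and so is
  \<open>D = U - (U - D)\<close>. The second moments of \<open>\<rho> \<mu>\<close> and
  \<open>w(Y) Y\<close> then come for free, since both are versions of conditional expectations of
  \<open>U\<close>; this also makes the variance of the marginal-ratio estimator finite. Everything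
  is an identity except for one dropped square, \<open>E[Var[\<rho> \<mu> - D | X]] / n\<close>.
  Given \<open>X\<close> the term \<open>h(X)\<close> is constant, so this is the noise left by
  \<open>\<rho> (\<mu> - \<mu>hat)\<close>, and it vanishes for a perfect outcome model.\<close>

section \<open>Square-integrable functions and conditional expectation as a projection\<close>

lemma integrable_mult_of_square_integrable:
  fixes f g :: "'z \<Rightarrow> real"
  assumes [measurable]: "f \<in> borel_measurable M" "g \<in> borel_measurable M"
    and "integrable M (\<lambda>z. (f z)\<^sup>2)" "integrable M (\<lambda>z. (g z)\<^sup>2)"
  shows "integrable M (\<lambda>z. f z * g z)"
proof (rule Bochner_Integration.integrable_bound[of M "\<lambda>z. (f z)\<^sup>2 + (g z)\<^sup>2"])
  show "AE z in M. norm (f z * g z) \<le> norm ((f z)\<^sup>2 + (g z)\<^sup>2)"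
  proof (rule AE_I2)
    fix z
    have "\<bar>f z\<bar> * \<bar>g z\<bar> \<ge> 0" by simp
    then have "\<bar>f z * g z\<bar> \<le> (f z)\<^sup>2 + (g z)\<^sup>2"
      using sum_squares_bound[of "\<bar>f z\<bar>" "\<bar>g z\<bar>"] unfolding abs_mult power2_abs by linarith
    then show "norm (f z * g z) \<le> norm ((f z)\<^sup>2 + (g z)\<^sup>2)" by simp
  qed
qed (use assms in auto)

lemma square_integrable_add:
  fixes f g :: "'z \<Rightarrow> real"
  assumes [measurable]: "f \<in> borel_measurable M" "g \<in> borel_measurable M"
    and "integrable M (\<lambda>z. (f z)\<^sup>2)" "integrable M (\<lambda>z. (g z)\<^sup>2)"
  shows "integrable M (\<lambda>z. (f z + g z)\<^sup>2)"
  using integrable_mult_of_square_integrable[OF assms] assms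
  by (simp add: power2_sum mult.assoc)

lemma square_integrable_diff:
  fixes f g :: "'z \<Rightarrow> real"
  assumes [measurable]: "f \<in> borel_measurable M" "g \<in> borel_measurable M"
    and "integrable M (\<lambda>z. (f z)\<^sup>2)" "integrable M (\<lambda>z. (g z)\<^sup>2)"
  shows "integrable M (\<lambda>z. (f z - g z)\<^sup>2)"
  using integrable_mult_of_square_integrable[OF assms] assms
  by (simp add: power2_diff mult.assoc)

context finite_measure_subalgebra
begin

text \<open>Conditional Jensen for the square, which is convex on the whole line.\<close>

lemma square_integrable_real_cond_exp:
  assumes [measurable]: "f \<in> borel_measurable M" and "integrable M (\<lambda>z. (f z)\<^sup>2)"
  shows "integrable M (\<lambda>z. (real_cond_exp M F f z)\<^sup>2)"
  by (rule integrable_convex_cond_exp[where I = UNIV])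
    (use assms square_integrable_imp_integrable[OF assms] in
      \<open>auto simp: convex_power2 emeasure_finite\<close>)

text \<open>Pythagoras in L2: \<open>E[f | F] - g\<close> is \<open>F\<close>-measurable, hence
  orthogonal to the residual \<open>f - E[f | F]\<close>. The proof expands the square around
  \<open>E[f | F]\<close> and kills the cross term by the defining property of conditional
  expectation.\<close>

lemma integral_square_diff_real_cond_exp:
  assumes f[measurable]: "f \<in> borel_measurable M" and f2: "integrable M (\<lambda>z. (f z)\<^sup>2)"
    and gF: "g \<in> borel_measurable F" and g2: "integrable M (\<lambda>z. (g z)\<^sup>2)"
  shows "(\<integral>z. (f z - g z)\<^sup>2 \<partial>M) =
    (\<integral>z. (f z - real_cond_exp M F f z)\<^sup>2 \<partial>M) + (\<integral>z. (real_cond_exp M F f z - g z)\<^sup>2 \<partial>M)"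
proof -
  let ?E = "real_cond_exp M F f"
  have g[measurable]: "g \<in> borel_measurable M"
    using measurable_from_subalg[OF subalg gF] .
  note E2 = square_integrable_real_cond_exp[OF f f2]
  have k2: "integrable M (\<lambda>z. (?E z - g z)\<^sup>2)" by (rule square_integrable_diff) (use E2 g2 in auto)
  have fE2: "integrable M (\<lambda>z. (f z - ?E z)\<^sup>2)" by (rule square_integrable_diff) (use E2 f2 in auto)
  have kf: "integrable M (\<lambda>z. (?E z - g z) * f z)"
    by (rule integrable_mult_of_square_integrable) (use k2 f2 in auto)
  have kE: "integrable M (\<lambda>z. (?E z - g z) * ?E z)"
    by (rule integrable_mult_of_square_integrable) (use k2 E2 in auto)
  have kF: "(\<lambda>z. ?E z - g z) \<in> borel_measurable F" using gF by simp
  have orth: "(\<integral>z. (?E z - g z) * ?E z \<partial>M) = (\<integral>z. (?E z - g z) * f z \<partial>M)"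
    by (rule real_cond_exp_intg(2)[OF kf kF f])
  have "(\<integral>z. (f z - g z)\<^sup>2 \<partial>M) =
    (\<integral>z. ((f z - ?E z)\<^sup>2 + (?E z - g z)\<^sup>2) + 2 * ((?E z - g z) * f z - (?E z - g z) * ?E z) \<partial>M)"
    by (rule Bochner_Integration.integral_cong) (auto simp: power2_eq_square algebra_simps)
  also have "\<dots> = (\<integral>z. (f z - ?E z)\<^sup>2 \<partial>M) + (\<integral>z. (?E z - g z)\<^sup>2 \<partial>M)"
    using fE2 k2 kf kE orth by simp
  finally show ?thesis .
qed

lemma integral_square_real_cond_exp:
  assumes "f \<in> borel_measurable M" "integrable M (\<lambda>z. (f z)\<^sup>2)"
  shows "(\<integral>z. (f z)\<^sup>2 \<partial>M) =
    (\<integral>z. (f z - real_cond_exp M F f z)\<^sup>2 \<partial>M) + (\<integral>z. (real_cond_exp M F f z)\<^sup>2 \<partial>M)"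
  using integral_square_diff_real_cond_exp[OF assms, of "\<lambda>_. 0"] by simp

end

section \<open>Sums of independent variables, and variance under conditional expectation\<close>

context prob_space
begin

text \<open>This fails without independence (take \<open>Y = - X\<close>). With it the joint law is
  a product, so by Fubini almost every section \<open>x + y\<close> is square integrable in
  \<open>x\<close>; a single such \<open>y\<close> suffices, because shifting by a constant
  preserves L2.\<close>

lemma indep_var_square_integrable_addD:
  fixes X Y :: "'a \<Rightarrow> real"
  assumes ind: "indep_var borel X borel Y" and XY: "integrable M (\<lambda>\<omega>. (X \<omega> + Y \<omega>)\<^sup>2)"
  shows "integrable M (\<lambda>\<omega>. (X \<omega>)\<^sup>2)"
proof -
  have [measurable]: "random_variable borel X" "random_variable borel Y"
    using indep_var_rv1[OF ind] indep_var_rv2[OF ind] .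
  let ?S = "distr M borel X" and ?T = "distr M borel Y"
  interpret X: prob_space ?S by (rule prob_space_distr) simp
  interpret Y: prob_space ?T by (rule prob_space_distr) simp
  interpret XY: pair_prob_space ?T ?S ..
  interpret YX: pair_prob_space ?S ?T ..
  have "integrable (distr M (borel \<Otimes>\<^sub>M borel) (\<lambda>\<omega>. (X \<omega>, Y \<omega>))) (\<lambda>(x, y). (x + y)\<^sup>2)"
    by (subst integrable_distr_eq) (use XY in auto)
  then have "integrable (?S \<Otimes>\<^sub>M ?T) (\<lambda>(x, y). (x + y)\<^sup>2)"
    using ind by (simp add: indep_var_distribution_eq)
  then have "AE y in ?T. integrable ?S (\<lambda>x. (x + y)\<^sup>2)"
    by (rule YX.AE_integrable_snd)
  \<comment> \<open>A property that holds almost everywhere in a probability space holds at some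
    point.\<close>
  then obtain y where y: "integrable ?S (\<lambda>x. (x + y)\<^sup>2)"
    using eventually_happens Y.ae_filter_bot by blast
  have "integrable ?S (\<lambda>x. ((x + y) - y)\<^sup>2)"
    by (rule square_integrable_diff) (use y in auto)
  then show ?thesis by (simp add: integrable_distr_eq)
qed

lemma indep_vars_square_integrable_sumD:
  fixes X :: "'i \<Rightarrow> 'a \<Rightarrow> real"
  assumes "finite I" "i \<in> I" and ind: "indep_vars (\<lambda>_. borel) X I"
    and "integrable M (\<lambda>\<omega>. (\<Sum>j\<in>I. X j \<omega>)\<^sup>2)"
  shows "integrable M (\<lambda>\<omega>. (X i \<omega>)\<^sup>2)"
proof (rule indep_var_square_integrable_addD)
  show "indep_var borel (X i) borel (\<lambda>\<omega>. \<Sum>j\<in>I - {i}. X j \<omega>)"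
    by (rule indep_vars_sum) (use assms in \<open>auto simp: insert_absorb\<close>)
  show "integrable M (\<lambda>\<omega>. (X i \<omega> + (\<Sum>j\<in>I - {i}. X j \<omega>))\<^sup>2)"
    using assms by (simp add: sum.remove)
qed

lemma indep_var_variance_add:
  fixes X Y :: "'a \<Rightarrow> real"
  assumes ind: "indep_var borel X borel Y"
    and X2: "integrable M (\<lambda>\<omega>. (X \<omega>)\<^sup>2)" and Y2: "integrable M (\<lambda>\<omega>. (Y \<omega>)\<^sup>2)"
  shows "variance (\<lambda>\<omega>. X \<omega> + Y \<omega>) = variance X + variance Y"
proof -
  have [measurable]: "random_variable borel X" "random_variable borel Y"
    using indep_var_rv1[OF ind] indep_var_rv2[OF ind] .
  have i: "integrable M X" "integrable M Y"
    using X2 Y2 by (auto intro: square_integrable_imp_integrable)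
  have XY2: "integrable M (\<lambda>\<omega>. (X \<omega> + Y \<omega>)\<^sup>2)"
    by (rule square_integrable_add) (use X2 Y2 in auto)
  have XY: "integrable M (\<lambda>\<omega>. X \<omega> * Y \<omega>)" by (rule indep_var_integrable[OF ind i])
  have "expectation (\<lambda>\<omega>. (X \<omega> + Y \<omega>)\<^sup>2) =
      expectation (\<lambda>\<omega>. (X \<omega>)\<^sup>2) + expectation (\<lambda>\<omega>. (Y \<omega>)\<^sup>2) + 2 * (expectation X * expectation Y)"
    unfolding power2_sum using X2 Y2 XY indep_var_lebesgue_integral[OF ind i]
    by (simp add: mult.assoc)
  then show ?thesis
    using variance_eq[OF Bochner_Integration.integrable_add[OF i] XY2] i
      variance_eq[OF i(1) X2] variance_eq[OF i(2) Y2] by (simp add: power2_sum algebra_simps)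
qed

text \<open>Square integrability of the sum is carried along with the variance formula because the
  induction step applies the two-variable case to the partial sum.\<close>

lemma indep_vars_variance_sum:
  fixes X :: "'i \<Rightarrow> 'a \<Rightarrow> real"
  assumes "finite I" "indep_vars (\<lambda>_. borel) X I" "\<And>i. i \<in> I \<Longrightarrow> integrable M (\<lambda>\<omega>. (X i \<omega>)\<^sup>2)"
  shows "integrable M (\<lambda>\<omega>. (\<Sum>i\<in>I. X i \<omega>)\<^sup>2) \<and>
    variance (\<lambda>\<omega>. \<Sum>i\<in>I. X i \<omega>) = (\<Sum>i\<in>I. variance (X i))"
  using assms
proof (induction I rule: finite_induct)
  case (insert i I)
  have ind: "indep_var borel (X i) borel (\<lambda>\<omega>. \<Sum>i\<in>I. X i \<omega>)"
    by (rule indep_vars_sum) (use insert in auto)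
  have IH: "integrable M (\<lambda>\<omega>. (\<Sum>i\<in>I. X i \<omega>)\<^sup>2)"
      "variance (\<lambda>\<omega>. \<Sum>i\<in>I. X i \<omega>) = (\<Sum>i\<in>I. variance (X i))"
    using insert.IH indep_vars_subset[OF insert.prems(1)] insert.prems(2) by auto
  have Xi: "integrable M (\<lambda>\<omega>. (X i \<omega>)\<^sup>2)" using insert.prems by simp
  show ?case
    using indep_var_variance_add[OF ind Xi IH(1)] IH(2) insert.hyps
      square_integrable_add[OF indep_var_rv1[OF ind] indep_var_rv2[OF ind] Xi IH(1)] by simp
qed simp

text \<open>Here \<open>U\<close> and \<open>V\<close> play the roles of \<open>\<rho> Y\<close> and \<open>\<rho> \<mu>\<close>, \<open>D\<close> that of the control variate
  of the doubly robust estimator, \<open>F\<close> is generated by the context and \<open>G\<close> by context and action.\<close>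

lemma variance_diff_control_variate_ge:
  assumes G: "subalgebra M G" and F: "subalgebra G F"
    and U[measurable]: "U \<in> borel_measurable M" and U2: "integrable M (\<lambda>z. (U z)\<^sup>2)"
    and D: "D \<in> borel_measurable G" and D2: "integrable M (\<lambda>z. (D z)\<^sup>2)"
    and D0: "AE z in M. real_cond_exp M F D z = 0"
    and V[measurable]: "V \<in> borel_measurable M" and VU: "AE z in M. real_cond_exp M G U z = V z"
  shows "variance (\<lambda>z. U z - D z) \<ge> variance U - (\<integral>z. (V z - real_cond_exp M F V z)\<^sup>2 \<partial>M)"
    and "integrable M (\<lambda>z. (V z)\<^sup>2)"
proof -
  have FM: "subalgebra M F" using G F unfolding subalgebra_def by auto
  interpret G: finite_measure_subalgebra M G by standard (rule G)
  interpret F: finite_measure_subalgebra M F by standard (rule FM)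
  have [measurable]: "D \<in> borel_measurable M" using measurable_from_subalg[OF G D] .
  have Ui: "integrable M U" and Di: "integrable M D"
    using U2 D2 by (auto intro: square_integrable_imp_integrable)
  have "integrable M (\<lambda>z. (real_cond_exp M G U z)\<^sup>2)"
    by (rule G.square_integrable_real_cond_exp[OF U U2])
  then show V2: "integrable M (\<lambda>z. (V z)\<^sup>2)"
    by (rule integrable_cong_AE_imp) (use VU in auto)
  then have Vi: "integrable M V" by (auto intro: square_integrable_imp_integrable)
  have VD2: "integrable M (\<lambda>z. (V z - D z)\<^sup>2)" by (rule square_integrable_diff) (use V2 D2 in auto)
  have UD2: "integrable M (\<lambda>z. (U z - D z)\<^sup>2)" by (rule square_integrable_diff) (use U2 D2 in auto)
  have eqUV: "(\<integral>z. (U z - real_cond_exp M G U z)\<^sup>2 \<partial>M) = (\<integral>z. (U z - V z)\<^sup>2 \<partial>M)"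
    by (rule integral_cong_AE) (use VU in auto)
  \<comment> \<open>Since \<open>D\<close> is \<open>G\<close>-measurable, projecting onto
    \<open>G\<close> replaces \<open>U\<close> by \<open>V\<close> and leaves \<open>D\<close>
    alone. The residual \<open>U - V\<close> is the same with and without \<open>D\<close>, so it
    cancels between facts \<open>1\<close> and \<open>2\<close>.\<close>
  have "(\<integral>z. (U z - D z)\<^sup>2 \<partial>M) = (\<integral>z. (U z - V z)\<^sup>2 \<partial>M) + (\<integral>z. (real_cond_exp M G U z - D z)\<^sup>2 \<partial>M)"
    using G.integral_square_diff_real_cond_exp[OF U U2 D D2] eqUV by simp
  also have "(\<integral>z. (real_cond_exp M G U z - D z)\<^sup>2 \<partial>M) = (\<integral>z. (V z - D z)\<^sup>2 \<partial>M)"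
    by (rule integral_cong_AE) (use VU in auto)
  finally have 1: "(\<integral>z. (U z - D z)\<^sup>2 \<partial>M) = (\<integral>z. (U z - V z)\<^sup>2 \<partial>M) + (\<integral>z. (V z - D z)\<^sup>2 \<partial>M)" .
  have "(\<integral>z. (real_cond_exp M G U z)\<^sup>2 \<partial>M) = (\<integral>z. (V z)\<^sup>2 \<partial>M)"
    by (rule integral_cong_AE) (use VU in auto)
  then have 2: "(\<integral>z. (U z)\<^sup>2 \<partial>M) = (\<integral>z. (U z - V z)\<^sup>2 \<partial>M) + (\<integral>z. (V z)\<^sup>2 \<partial>M)"
    using G.integral_square_real_cond_exp[OF U U2] eqUV by simp
  \<comment> \<open>The control variate is invisible after projection onto \<open>F\<close>,
    whichever \<open>D\<close> was chosen; this yields a lower bound free of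
    \<open>D\<close>.\<close>
  have "AE z in M. real_cond_exp M F (\<lambda>z. V z - D z) z = real_cond_exp M F V z"
    using F.real_cond_exp_diff[OF Vi Di] D0 by eventually_elim simp
  then have "(\<integral>z. (real_cond_exp M F (\<lambda>z. V z - D z) z)\<^sup>2 \<partial>M) = (\<integral>z. (real_cond_exp M F V z)\<^sup>2 \<partial>M)"
    by (intro integral_cong_AE) auto
  \<comment> \<open>The only place where an equality becomes an inequality.\<close>
  moreover have "0 \<le> (\<integral>z. (V z - D z - real_cond_exp M F (\<lambda>z. V z - D z) z)\<^sup>2 \<partial>M)" by simp
  ultimately have 3: "(\<integral>z. (V z - D z)\<^sup>2 \<partial>M) \<ge> (\<integral>z. (real_cond_exp M F V z)\<^sup>2 \<partial>M)"
    using F.integral_square_real_cond_exp[OF _ VD2] by simp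
  have 4: "(\<integral>z. (V z)\<^sup>2 \<partial>M) =
      (\<integral>z. (V z - real_cond_exp M F V z)\<^sup>2 \<partial>M) + (\<integral>z. (real_cond_exp M F V z)\<^sup>2 \<partial>M)"
    by (rule F.integral_square_real_cond_exp[OF V V2])
  \<comment> \<open>\<open>D\<close> has mean zero, so \<open>U\<close> and \<open>U - D\<close>
    share their mean and the comparison of second moments is one of variances.\<close>
  have "expectation D = (\<integral>z. real_cond_exp M F D z \<partial>M)" using F.real_cond_exp_int(2)[OF Di] by simp
  also have "\<dots> = (\<integral>z. 0 \<partial>M)" by (rule integral_cong_AE) (use D0 in auto)
  finally have "expectation (\<lambda>z. U z - D z) = expectation U" using Ui Di by simp
  then show "variance (\<lambda>z. U z - D z) \<ge> variance U - (\<integral>z. (V z - real_cond_exp M F V z)\<^sup>2 \<partial>M)"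
    using 1 2 3 4 variance_eq[OF Ui U2] variance_eq[OF Bochner_Integration.integrable_diff[OF Ui Di] UD2]
    by simp
qed

text \<open>Law of total variance, stated for an arbitrary version \<open>W\<close> of
  \<open>E[U | F]\<close>, since the explicit function \<open>w(Y) Y\<close> agrees with the chosen
  conditional expectation only almost everywhere.\<close>

lemma variance_real_cond_exp:
  assumes F: "subalgebra M F" and U[measurable]: "U \<in> borel_measurable M"
    and U2: "integrable M (\<lambda>z. (U z)\<^sup>2)"
    and W[measurable]: "W \<in> borel_measurable M" and WU: "AE z in M. real_cond_exp M F U z = W z"
  shows "variance U = variance W + (\<integral>z. (U z - real_cond_exp M F U z)\<^sup>2 \<partial>M)"
    and "integrable M (\<lambda>z. (W z)\<^sup>2)"
proof -
  interpret F: finite_measure_subalgebra M F by standard (rule F)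
  have Ui: "integrable M U" by (rule square_integrable_imp_integrable[OF U U2])
  have "integrable M (\<lambda>z. (real_cond_exp M F U z)\<^sup>2)"
    by (rule F.square_integrable_real_cond_exp[OF U U2])
  then show W2: "integrable M (\<lambda>z. (W z)\<^sup>2)"
    by (rule integrable_cong_AE_imp) (use WU in auto)
  then have Wi: "integrable M W" by (auto intro: square_integrable_imp_integrable)
  have "expectation (real_cond_exp M F U) = expectation W"
    by (rule integral_cong_AE) (use WU in auto)
  then have EW: "expectation W = expectation U" using F.real_cond_exp_int(2)[OF Ui] by simp
  have "(\<integral>z. (real_cond_exp M F U z)\<^sup>2 \<partial>M) = (\<integral>z. (W z)\<^sup>2 \<partial>M)"
    by (rule integral_cong_AE) (use WU in auto)
  then show "variance U = variance W + (\<integral>z. (U z - real_cond_exp M F U z)\<^sup>2 \<partial>M)"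
    using F.integral_square_real_cond_exp[OF U U2] EW variance_eq[OF Ui U2] variance_eq[OF Wi W2]
    by simp
qed

end

section \<open>Sums as integrals over counting measure, and generated sigma-algebras\<close>

text \<open>Unordered summability of reals is absolute, hence the same as Lebesgue
  integrability.\<close>

lemma integrable_count_space_iff_summable_on:
  fixes f :: "'i \<Rightarrow> real"
  shows "integrable (count_space A) f \<longleftrightarrow> f summable_on A"
  unfolding abs_summable_on_def[symmetric] abs_summable_equivalent[symmetric]
  by (rule summable_on_iff_abs_summable_on_real[symmetric])

text \<open>Summability need not be assumed: both sides default to 0 when it fails. So the model
  term \<open>h\<close> of the estimator is an integral at every context, not only at almost every
  one.\<close>

lemma integral_count_space_eq_infsum:
  fixes f :: "'i \<Rightarrow> real"
  shows "(\<integral>a. f a \<partial>count_space A) = (\<Sum>\<^sub>\<infinity>a\<in>A. f a)"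
proof (cases "f summable_on A")
  case True
  then have "integrable (count_space A) f" by (simp add: integrable_count_space_iff_summable_on)
  then have "infsetsum f A = infsum f A" by (intro infsetsum_infsum) (simp add: abs_summable_on_def)
  then show ?thesis by (simp add: infsetsum_def)
next
  case False
  then show ?thesis
    by (simp add: infsum_not_exists not_integrable_integral_eq integrable_count_space_iff_summable_on)
qed

lemma subalgebra_vimage_algebra:
  assumes "V \<in> measurable M N"
  shows "subalgebra M (vimage_algebra (space M) V N)"
  unfolding subalgebra_def
  using sets_vimage_algebra2[of V "space M" N] measurable_space[OF assms] measurable_sets[OF assms] by auto

section \<open>The sampling law and its marginal on context and action\<close>

context contextual_bandit
begin

lemma sigma_finite_count_space: "sigma_finite_measure (count_space A)"
  by (rule sigma_finite_measure_count_space_countable[OF countable_A])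

lemma space_MY: "space MY = S"
  using sets_eq_imp_space_eq[OF sets_MY] by (simp add: space_restrict_space)

lemma measurable_ident_MY [measurable]: "(\<lambda>y. y) \<in> borel_measurable MY"
proof -
  have "(\<lambda>y. y) \<in> measurable (restrict_space borel S) borel"
    by (rule measurable_restrict_space1) simp
  then show ?thesis using measurable_cong_sets[OF sets_MY refl] by blast
qed

lemma space_ref_measure: "space (ref_measure MX A MY) = space MX \<times> A \<times> S"
  by (simp add: ref_measure_def space_pair_measure space_MY)

lemma measurable_ctx [measurable]: "ctx \<in> measurable (ref_measure MX A MY) MX"
  and measurable_act [measurable]: "act \<in> measurable (ref_measure MX A MY) (count_space A)"
  and measurable_outc [measurable]: "outc \<in> measurable (ref_measure MX A MY) MY"
  by (simp_all add: ref_measure_def)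

lemma measurable_ctx_act [measurable]:
  "(\<lambda>z. (ctx z, act z)) \<in> measurable (ref_measure MX A MY) (MX \<Otimes>\<^sub>M count_space A)"
  by simp

lemma measurable_reassociate:
  "(\<lambda>(p, y). (fst p, snd p, y)) \<in>
     measurable ((MX \<Otimes>\<^sub>M count_space A) \<Otimes>\<^sub>M MY) (ref_measure MX A MY)"
  unfolding ref_measure_def by measurable

text \<open>Samples are nested as \<open>(x, (a, y))\<close>, but both marginals used below separate
  the pair \<open>(x, a)\<close> from \<open>y\<close>. Rebracketing lets Tonelli and Fubini be
  applied to that split directly.\<close>

lemma ref_measure_reassociate:
  "ref_measure MX A MY =
     distr ((MX \<Otimes>\<^sub>M count_space A) \<Otimes>\<^sub>M MY) (ref_measure MX A MY) (\<lambda>(p, y). (fst p, snd p, y))"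
proof (rule measure_eqI)
  fix B assume B: "B \<in> sets (ref_measure MX A MY)"
  interpret MY: sigma_finite_measure MY by (rule sigma_finite_MY)
  interpret C: sigma_finite_measure "count_space A" by (rule sigma_finite_count_space)
  interpret CY: pair_sigma_finite "count_space A" MY ..
  let ?I = "indicator B :: _ \<Rightarrow> ennreal"
  have I[measurable]: "?I \<in> borel_measurable (MX \<Otimes>\<^sub>M (count_space A \<Otimes>\<^sub>M MY))"
    using B by (simp add: ref_measure_def)
  have J[measurable]: "(\<lambda>(p, y). ?I (fst p, snd p, y)) \<in> borel_measurable ((MX \<Otimes>\<^sub>M count_space A) \<Otimes>\<^sub>M MY)"
    by measurable
  have K: "(\<lambda>p. \<integral>\<^sup>+ y. ?I (fst p, snd p, y) \<partial>MY) \<in> borel_measurable (MX \<Otimes>\<^sub>M count_space A)"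
    by measurable
  have "emeasure (ref_measure MX A MY) B = (\<integral>\<^sup>+ z. ?I z \<partial>ref_measure MX A MY)"
    using B by simp
  also have "\<dots> = (\<integral>\<^sup>+ x. \<integral>\<^sup>+ p. ?I (x, p) \<partial>(count_space A \<Otimes>\<^sub>M MY) \<partial>MX)"
    unfolding ref_measure_def by (rule CY.P.nn_integral_fst[OF I, symmetric])
  also have "\<dots> = (\<integral>\<^sup>+ x. \<integral>\<^sup>+ a. \<integral>\<^sup>+ y. ?I (x, a, y) \<partial>MY \<partial>count_space A \<partial>MX)"
    by (intro nn_integral_cong MY.nn_integral_fst[symmetric]) simp
  also have "\<dots> = (\<integral>\<^sup>+ p. \<integral>\<^sup>+ y. ?I (fst p, snd p, y) \<partial>MY \<partial>(MX \<Otimes>\<^sub>M count_space A))"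
    using C.nn_integral_fst[OF K] by simp
  also have "\<dots> = (\<integral>\<^sup>+ q. (case q of (p, y) \<Rightarrow> ?I (fst p, snd p, y)) \<partial>((MX \<Otimes>\<^sub>M count_space A) \<Otimes>\<^sub>M MY))"
    using MY.nn_integral_fst[OF J] by simp
  also have "\<dots> = (\<integral>\<^sup>+ q. ?I ((\<lambda>(p, y). (fst p, snd p, y)) q) \<partial>((MX \<Otimes>\<^sub>M count_space A) \<Otimes>\<^sub>M MY))"
    by (simp add: case_prod_beta')
  also have "\<dots> = (\<integral>\<^sup>+ z. ?I z \<partial>distr ((MX \<Otimes>\<^sub>M count_space A) \<Otimes>\<^sub>M MY) (ref_measure MX A MY)
      (\<lambda>(p, y). (fst p, snd p, y)))"
    by (rule nn_integral_distr[OF measurable_reassociate, symmetric]) (use B in simp)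
  also have "\<dots> = emeasure (distr ((MX \<Otimes>\<^sub>M count_space A) \<Otimes>\<^sub>M MY) (ref_measure MX A MY)
      (\<lambda>(p, y). (fst p, snd p, y))) B"
    using B by simp
  finally show "emeasure (ref_measure MX A MY) B =
    emeasure (distr ((MX \<Otimes>\<^sub>M count_space A) \<Otimes>\<^sub>M MY) (ref_measure MX A MY) (\<lambda>(p, y). (fst p, snd p, y))) B" .
qed simp

lemma nn_integral_ref_measure:
  assumes [measurable]: "f \<in> borel_measurable (ref_measure MX A MY)"
  shows "(\<integral>\<^sup>+ z. f z \<partial>ref_measure MX A MY) =
    (\<integral>\<^sup>+ q. f (fst (fst q), snd (fst q), snd q) \<partial>((MX \<Otimes>\<^sub>M count_space A) \<Otimes>\<^sub>M MY))"
  by (subst ref_measure_reassociate, subst nn_integral_distr[OF measurable_reassociate])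
    (auto simp: case_prod_beta')

lemma integrable_ref_measure_iff:
  fixes f :: "_ \<Rightarrow> real"
  assumes [measurable]: "f \<in> borel_measurable (ref_measure MX A MY)"
  shows "integrable (ref_measure MX A MY) f \<longleftrightarrow>
    integrable ((MX \<Otimes>\<^sub>M count_space A) \<Otimes>\<^sub>M MY) (\<lambda>(p, y). f (fst p, snd p, y))"
  by (subst ref_measure_reassociate, subst integrable_distr_eq[OF measurable_reassociate])
    (auto simp: case_prod_beta')

lemma integrable_policy:
  assumes "policy MX A \<pi>" "x \<in> space MX"
  shows "integrable (count_space A) (\<lambda>a. \<pi> a x)" "(\<integral>a. \<pi> a x \<partial>count_space A) = 1"
    "(\<integral>\<^sup>+ a. ennreal (\<pi> a x) \<partial>count_space A) = 1"
proof -
  have s: "((\<lambda>a. \<pi> a x) has_sum 1) A" and nn: "\<And>a. a \<in> A \<Longrightarrow> 0 \<le> \<pi> a x"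
    using assms by (auto simp: policy_def)
  show i: "integrable (count_space A) (\<lambda>a. \<pi> a x)"
    using s by (auto simp: integrable_count_space_iff_summable_on summable_on_def)
  show e: "(\<integral>a. \<pi> a x \<partial>count_space A) = 1"
    using s by (simp add: integral_count_space_eq_infsum infsumI)
  show "(\<integral>\<^sup>+ a. ennreal (\<pi> a x) \<partial>count_space A) = 1"
    using nn_integral_eq_integral[OF i] nn e by (simp add: AE_count_space)
qed

lemma measurable_policy:
  "policy MX A \<pi> \<Longrightarrow> (\<lambda>p. \<pi> (snd p) (fst p)) \<in> borel_measurable (MX \<Otimes>\<^sub>M count_space A)"
  by (simp add: policy_def case_prod_beta')

lemma measurable_joint_density:
  assumes "policy MX A \<pi>"
  shows "joint_density pX pY \<pi> \<in> borel_measurable (ref_measure MX A MY)"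
proof -
  note [measurable] = pX_measurable pY_measurable
    measurable_compose[OF measurable_ctx_act measurable_policy[OF assms], simplified]
  have "(\<lambda>z. pY (outc z) (ctx z) (act z) * \<pi> (act z) (ctx z) * pX (ctx z))
      \<in> borel_measurable (ref_measure MX A MY)"
    by measurable
  then show ?thesis by (simp add: joint_density_def case_prod_beta')
qed

lemma joint_density_nonneg:
  assumes "policy MX A \<pi>" "z \<in> space (ref_measure MX A MY)"
  shows "0 \<le> joint_density pX pY \<pi> z"
  using assms pX_nonneg pY_nonneg by (auto simp: joint_density_def space_ref_measure policy_def)

lemma measurable_joint_law [simp]:
  "measurable (joint_law MX A MY pX pY \<pi>) N = measurable (ref_measure MX A MY) N"
  by (rule measurable_cong_sets) (simp_all add: joint_law_def)

lemma space_joint_law [simp]: "space (joint_law MX A MY pX pY \<pi>) = space (ref_measure MX A MY)"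
  by (simp add: joint_law_def)

lemma sets_joint_law [simp]: "sets (joint_law MX A MY pX pY \<pi>) = sets (ref_measure MX A MY)"
  by (simp add: joint_law_def)

text \<open>Integrating out \<open>y\<close> removes the factor \<open>pY\<close>, which has mass 1
  at every context and action.\<close>

lemma distr_ctx_act_joint_law:
  assumes \<pi>: "policy MX A \<pi>"
  shows "distr (joint_law MX A MY pX pY \<pi>) (MX \<Otimes>\<^sub>M count_space A) (\<lambda>z. (ctx z, act z)) =
    density (MX \<Otimes>\<^sub>M count_space A) (\<lambda>p. ennreal (\<pi> (snd p) (fst p) * pX (fst p)))"
proof (rule measure_eqI)
  fix B assume "B \<in> sets (distr (joint_law MX A MY pX pY \<pi>) (MX \<Otimes>\<^sub>M count_space A) (\<lambda>z. (ctx z, act z)))"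
  then have B[measurable]: "B \<in> sets (MX \<Otimes>\<^sub>M count_space A)" by simp
  interpret MY: sigma_finite_measure MY by (rule sigma_finite_MY)
  let ?j = "joint_density pX pY \<pi>"
  note [measurable] = measurable_joint_density[OF \<pi>] measurable_policy[OF \<pi>] pX_measurable
  have f[measurable]: "(\<lambda>z. ennreal (?j z) * indicator B (ctx z, act z)) \<in> borel_measurable (ref_measure MX A MY)"
    by measurable
  have g: "(\<lambda>q. ennreal (?j (fst (fst q), snd (fst q), snd q)) * indicator B (fst q))
      \<in> borel_measurable ((MX \<Otimes>\<^sub>M count_space A) \<Otimes>\<^sub>M MY)"
    using measurable_compose[OF measurable_reassociate f] by (simp add: case_prod_beta')
  have "emeasure (distr (joint_law MX A MY pX pY \<pi>) (MX \<Otimes>\<^sub>M count_space A) (\<lambda>z. (ctx z, act z))) B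
     = (\<integral>\<^sup>+ z. indicator B (ctx z, act z) \<partial>joint_law MX A MY pX pY \<pi>)"
    by (simp add: nn_integral_distr flip: nn_integral_indicator)
  also have "\<dots> = (\<integral>\<^sup>+ z. ennreal (?j z) * indicator B (ctx z, act z) \<partial>ref_measure MX A MY)"
    unfolding joint_law_def by (rule nn_integral_density) measurable
  also have "\<dots> = (\<integral>\<^sup>+ p. \<integral>\<^sup>+ y. ennreal (?j (fst p, snd p, y)) * indicator B p \<partial>MY \<partial>(MX \<Otimes>\<^sub>M count_space A))"
    using MY.nn_integral_fst[OF g] by (simp add: nn_integral_ref_measure[OF f])
  also have "\<dots> = (\<integral>\<^sup>+ p. ennreal (\<pi> (snd p) (fst p) * pX (fst p)) * indicator B p \<partial>(MX \<Otimes>\<^sub>M count_space A))"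
  proof (rule nn_integral_cong)
    fix p assume p: "p \<in> space (MX \<Otimes>\<^sub>M count_space A)"
    obtain x a where xa: "p = (x, a)" "x \<in> space MX" "a \<in> A" using p by (auto simp: space_pair_measure)
    have m: "(\<lambda>y. pY y x a) \<in> borel_measurable MY"
      using measurable_compose[of "\<lambda>y. (x, a, y)" MY "ref_measure MX A MY", OF _ pY_measurable] xa
      by (simp add: ref_measure_def)
    have c: "0 \<le> \<pi> a x * pX x" using \<pi> xa pX_nonneg by (auto simp: policy_def)
    have "(\<integral>\<^sup>+ y. ennreal (?j (x, a, y)) * indicator B p \<partial>MY) =
        (\<integral>\<^sup>+ y. (ennreal (\<pi> a x * pX x) * indicator B p) * ennreal (pY y x a) \<partial>MY)"
    proof (rule nn_integral_cong)
      fix y assume "y \<in> space MY"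
      then have "0 \<le> pY y x a" using pY_nonneg xa by (simp add: space_MY)
      then show "ennreal (?j (x, a, y)) * indicator B p = (ennreal (\<pi> a x * pX x) * indicator B p) * ennreal (pY y x a)"
        using ennreal_mult[OF c, of "pY y x a"] by (simp add: joint_density_def mult.assoc mult.commute mult.left_commute)
    qed
    also have "\<dots> = ennreal (\<pi> a x * pX x) * indicator B p"
      using m by (subst nn_integral_cmult) (auto simp: pY_density xa)
    finally show "(\<integral>\<^sup>+ y. ennreal (?j (fst p, snd p, y)) * indicator B p \<partial>MY) =
        ennreal (\<pi> (snd p) (fst p) * pX (fst p)) * indicator B p" by (simp add: xa)
  qed
  also have "\<dots> = emeasure (density (MX \<Otimes>\<^sub>M count_space A) (\<lambda>p. ennreal (\<pi> (snd p) (fst p) * pX (fst p)))) B"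
    by (simp add: emeasure_density)
  finally show "emeasure (distr (joint_law MX A MY pX pY \<pi>) (MX \<Otimes>\<^sub>M count_space A) (\<lambda>z. (ctx z, act z))) B = \<dots>" .
qed simp

lemma prob_space_joint_law:
  assumes \<pi>: "policy MX A \<pi>"
  shows "prob_space (joint_law MX A MY pX pY \<pi>)"
proof -
  interpret C: sigma_finite_measure "count_space A" by (rule sigma_finite_count_space)
  let ?D = "distr (joint_law MX A MY pX pY \<pi>) (MX \<Otimes>\<^sub>M count_space A) (\<lambda>z. (ctx z, act z))"
  note [measurable] = measurable_policy[OF \<pi>] pX_measurable
  have g: "(\<lambda>p. ennreal (\<pi> (snd p) (fst p) * pX (fst p))) \<in> borel_measurable (MX \<Otimes>\<^sub>M count_space A)"
    by measurable
  have "emeasure ?D (space (MX \<Otimes>\<^sub>M count_space A)) =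
      (\<integral>\<^sup>+ p. ennreal (\<pi> (snd p) (fst p) * pX (fst p)) \<partial>(MX \<Otimes>\<^sub>M count_space A))"
    unfolding distr_ctx_act_joint_law[OF \<pi>]
    by (subst emeasure_density) (auto intro!: nn_integral_cong)
  also have "\<dots> = (\<integral>\<^sup>+ x. \<integral>\<^sup>+ a. ennreal (\<pi> a x * pX x) \<partial>count_space A \<partial>MX)"
    using C.nn_integral_fst[OF g] by simp
  also have "\<dots> = (\<integral>\<^sup>+ x. ennreal (pX x) \<partial>MX)"
  proof (rule nn_integral_cong)
    fix x assume x: "x \<in> space MX"
    have "(\<integral>\<^sup>+ a. ennreal (\<pi> a x * pX x) \<partial>count_space A) = (\<integral>\<^sup>+ a. ennreal (pX x) * ennreal (\<pi> a x) \<partial>count_space A)"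
      using \<pi> x pX_nonneg by (intro nn_integral_cong) (auto simp: policy_def ennreal_mult mult.commute)
    then show "(\<integral>\<^sup>+ a. ennreal (\<pi> a x * pX x) \<partial>count_space A) = ennreal (pX x)"
      by (simp add: nn_integral_cmult integrable_policy(3)[OF \<pi> x])
  qed
  also have "\<dots> = 1" by (rule pX_density)
  finally have "emeasure ?D (space ?D) = 1" by simp
  then have "prob_space ?D" by (rule prob_spaceI)
  \<comment> \<open>A push-forward has the same total mass, so it is enough to compute the mass of
    the context-action marginal.\<close>
  then show ?thesis by (rule prob_space_distrD[rotated]) simp
qed

section \<open>Centering given the context\<close>

text \<open>Sets in the sigma-algebra of the context are preimages of some \<open>B'\<close>, and
  the integral over such a set is that of \<open>pX x\<close> times the inner sum over actions,
  taken over \<open>B'\<close>; that inner sum is 0.\<close>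

lemma real_cond_exp_ctx_eq_0:
  fixes d :: "'x \<Rightarrow> 'a \<Rightarrow> real" and \<pi> :: "'a \<Rightarrow> 'x \<Rightarrow> real"
  defines "P \<equiv> joint_law MX A MY pX pY \<pi>"
  assumes \<pi>: "policy MX A \<pi>"
    and d: "(\<lambda>p. d (fst p) (snd p)) \<in> borel_measurable (MX \<Otimes>\<^sub>M count_space A)"
    and int: "integrable P (\<lambda>z. d (ctx z) (act z))"
    and zero: "AE x in density MX (\<lambda>x. ennreal (pX x)). (\<integral>a. \<pi> a x * d x a \<partial>count_space A) = 0"
  shows "AE z in P. real_cond_exp P (vimage_algebra (space P) ctx MX) (\<lambda>z. d (ctx z) (act z)) z = 0"
proof -
  interpret P: prob_space P unfolding P_def by (rule prob_space_joint_law[OF \<pi>])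
  interpret C: sigma_finite_measure "count_space A" by (rule sigma_finite_count_space)
  interpret MX: sigma_finite_measure MX by (rule sigma_finite_MX)
  interpret XC: pair_sigma_finite MX "count_space A" ..
  have ctxP: "ctx \<in> measurable P MX" by (simp add: P_def)
  let ?F = "vimage_algebra (space P) ctx MX"
  let ?XA = "MX \<Otimes>\<^sub>M count_space A"
  have F: "subalgebra P ?F" by (rule subalgebra_vimage_algebra[OF ctxP])
  interpret F: finite_measure_subalgebra P ?F by standard (rule F)
  note [measurable] = measurable_policy[OF \<pi>] pX_measurable d
  have pnn: "AE p in ?XA. 0 \<le> \<pi> (snd p) (fst p) * pX (fst p)"
    using \<pi> pX_nonneg by (intro AE_I2) (auto simp: policy_def space_pair_measure)
  show ?thesis
  proof (rule F.real_cond_exp_charact)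
    fix B assume "B \<in> sets ?F"
    then obtain B' where B': "B' \<in> sets MX" "B = ctx -` B' \<inter> space P"
      using sets_vimage_algebra2[of ctx "space P" MX] measurable_space[OF ctxP] by auto
    note [measurable] = B'(1)
    let ?f = "\<lambda>p. indicator B' (fst p) * d (fst p) (snd p) :: real"
    have BP: "B \<in> sets P" using measurable_sets[OF ctxP B'(1)] B'(2) by simp
    have eq: "indicator B z *\<^sub>R d (ctx z) (act z) = ?f (ctx z, act z)" if "z \<in> space P" for z
      using that B'(2) by (simp add: indicator_def)
    have "integrable P (\<lambda>z. indicator B z *\<^sub>R d (ctx z) (act z)) \<longleftrightarrow> integrable P (\<lambda>z. ?f (ctx z, act z))"
      by (rule Bochner_Integration.integrable_cong[OF refl]) (rule eq)
    then have "integrable P (\<lambda>z. ?f (ctx z, act z))"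
      using integrable_mult_indicator[OF BP int] by (rule iffD1)
    then have "integrable (distr P ?XA (\<lambda>z. (ctx z, act z))) ?f"
      by (subst integrable_distr_eq) (auto simp: P_def)
    then have i: "integrable ?XA (\<lambda>p. (\<pi> (snd p) (fst p) * pX (fst p)) * ?f p)"
      unfolding P_def distr_ctx_act_joint_law[OF \<pi>] using pnn by (subst (asm) integrable_density) auto
    have "(\<integral>z\<in>B. d (ctx z) (act z) \<partial>P) = (\<integral>z. ?f (ctx z, act z) \<partial>P)"
      unfolding set_lebesgue_integral_def by (rule Bochner_Integration.integral_cong[OF refl]) (rule eq)
    also have "\<dots> = (\<integral>p. ?f p \<partial>distr P ?XA (\<lambda>z. (ctx z, act z)))"
      by (subst integral_distr) (auto simp: P_def)
    also have "\<dots> = (\<integral>p. (\<pi> (snd p) (fst p) * pX (fst p)) * ?f p \<partial>?XA)"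
      unfolding P_def distr_ctx_act_joint_law[OF \<pi>] using pnn by (subst integral_density) auto
    also have "\<dots> = (\<integral>x. \<integral>a. (\<pi> a x * pX x) * ?f (x, a) \<partial>count_space A \<partial>MX)"
      using XC.integral_fst'[OF i] by simp
    also have "\<dots> = (\<integral>x. 0 \<partial>MX)"
    proof (rule integral_cong_AE)
      \<comment> \<open>The inner sum is known to vanish only where \<open>pX\<close> is positive;
        elsewhere the factor \<open>pX x\<close> itself is 0.\<close>
      have "AE x in MX. 0 < ennreal (pX x) \<longrightarrow> (\<integral>a. \<pi> a x * d x a \<partial>count_space A) = 0"
        using zero by (subst (asm) AE_density) auto
      then show "AE x in MX. (\<integral>a. (\<pi> a x * pX x) * ?f (x, a) \<partial>count_space A) = 0"
        using AE_space
      proof eventually_elim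
        case (elim x)
        have "(\<integral>a. (\<pi> a x * pX x) * ?f (x, a) \<partial>count_space A) =
            (\<integral>a. (pX x * indicator B' x) * (\<pi> a x * d x a) \<partial>count_space A)"
          by (rule Bochner_Integration.integral_cong) (auto simp: ac_simps)
        also have "\<dots> = (pX x * indicator B' x) * (\<integral>a. \<pi> a x * d x a \<partial>count_space A)" by simp
        also have "\<dots> = 0" using elim pX_nonneg[of x] by (cases "pX x = 0") auto
        finally show ?case .
      qed
    qed (use XC.integrable_fst'[OF i] in auto)
    finally show "(\<integral>z\<in>B. d (ctx z) (act z) \<partial>P) = (\<integral>z\<in>B. 0 \<partial>P)" by simp
  qed (use int in auto)
qed

section \<open>The outcome marginal, and its density ratio as a conditional expectation\<close>

lemma integrable_joint_density:
  assumes \<pi>: "policy MX A \<pi>"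
  shows "integrable (ref_measure MX A MY) (joint_density pX pY \<pi>)"
proof -
  interpret P: prob_space "joint_law MX A MY pX pY \<pi>" by (rule prob_space_joint_law[OF \<pi>])
  have nn: "AE z in ref_measure MX A MY. 0 \<le> joint_density pX pY \<pi> z"
    by (rule AE_I2[OF joint_density_nonneg[OF \<pi>]])
  have "integrable (joint_law MX A MY pX pY \<pi>) (\<lambda>_. 1 :: real)" by simp
  then show ?thesis
    unfolding joint_law_def
    by (subst (asm) integrable_density) (use measurable_joint_density[OF \<pi>] nn in auto)
qed

text \<open>\<open>outcome_density\<close> is a Bochner integral and would be 0 by default on a
  non-integrable section. Fubini confines such outcomes to a null set.\<close>

lemma
  assumes \<pi>: "policy MX A \<pi>"
  shows integrable_outcome_density: "integrable MY (outcome_density MX A pX pY \<pi>)"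
    and AE_integrable_joint_density:
      "AE y in MY. integrable (MX \<Otimes>\<^sub>M count_space A) (\<lambda>(x, a). joint_density pX pY \<pi> (x, a, y))"
proof -
  interpret C: sigma_finite_measure "count_space A" by (rule sigma_finite_count_space)
  interpret MX: sigma_finite_measure MX by (rule sigma_finite_MX)
  interpret MY: sigma_finite_measure MY by (rule sigma_finite_MY)
  interpret XC: pair_sigma_finite MX "count_space A" ..
  interpret XCY: pair_sigma_finite "MX \<Otimes>\<^sub>M count_space A" MY ..
  have "integrable ((MX \<Otimes>\<^sub>M count_space A) \<Otimes>\<^sub>M MY) (\<lambda>(p, y). joint_density pX pY \<pi> (fst p, snd p, y))"
    using integrable_joint_density[OF \<pi>] integrable_ref_measure_iff measurable_joint_density[OF \<pi>] by blast
  from XCY.integrable_snd[OF this] XCY.AE_integrable_snd[OF this]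
  show "integrable MY (outcome_density MX A pX pY \<pi>)"
    "AE y in MY. integrable (MX \<Otimes>\<^sub>M count_space A) (\<lambda>(x, a). joint_density pX pY \<pi> (x, a, y))"
    by (simp_all add: outcome_density_def[abs_def] case_prod_beta')
qed

lemma outcome_density_nonneg:
  assumes "policy MX A \<pi>" "y \<in> space MY"
  shows "0 \<le> outcome_density MX A pX pY \<pi> y"
  unfolding outcome_density_def
  using joint_density_nonneg[OF assms(1)] assms(2)
  by (intro Bochner_Integration.integral_nonneg)
    (auto simp: space_pair_measure space_ref_measure space_MY)

text \<open>Tonelli with the outcome outermost; off the null set of bad sections the nonnegative
  inner integral is the real number \<open>outcome_density\<close>.\<close>

lemma distr_outc_joint_law:
  assumes \<pi>: "policy MX A \<pi>"
  shows "distr (joint_law MX A MY pX pY \<pi>) MY outc =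
    density MY (\<lambda>y. ennreal (outcome_density MX A pX pY \<pi> y))"
proof (rule measure_eqI)
  fix B assume "B \<in> sets (distr (joint_law MX A MY pX pY \<pi>) MY outc)"
  then have B[measurable]: "B \<in> sets MY" by simp
  interpret C: sigma_finite_measure "count_space A" by (rule sigma_finite_count_space)
  interpret MX: sigma_finite_measure MX by (rule sigma_finite_MX)
  interpret MY: sigma_finite_measure MY by (rule sigma_finite_MY)
  interpret XC: pair_sigma_finite MX "count_space A" ..
  interpret XCY: pair_sigma_finite "MX \<Otimes>\<^sub>M count_space A" MY ..
  let ?j = "joint_density pX pY \<pi>" and ?q = "outcome_density MX A pX pY \<pi>"
  note [measurable] = measurable_joint_density[OF \<pi>]
    borel_measurable_integrable[OF integrable_outcome_density[OF \<pi>]]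
  have f[measurable]: "(\<lambda>z. ennreal (?j z) * indicator B (outc z)) \<in> borel_measurable (ref_measure MX A MY)"
    by measurable
  have g: "(\<lambda>q. ennreal (?j (fst (fst q), snd (fst q), snd q)) * indicator B (snd q))
      \<in> borel_measurable ((MX \<Otimes>\<^sub>M count_space A) \<Otimes>\<^sub>M MY)"
    using measurable_compose[OF measurable_reassociate f] by (simp add: case_prod_beta')
  have "emeasure (distr (joint_law MX A MY pX pY \<pi>) MY outc) B
     = (\<integral>\<^sup>+ z. indicator B (outc z) \<partial>joint_law MX A MY pX pY \<pi>)"
    by (simp add: nn_integral_distr flip: nn_integral_indicator)
  also have "\<dots> = (\<integral>\<^sup>+ z. ennreal (?j z) * indicator B (outc z) \<partial>ref_measure MX A MY)"
    unfolding joint_law_def by (rule nn_integral_density) measurable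
  also have "\<dots> = (\<integral>\<^sup>+ y. \<integral>\<^sup>+ p. ennreal (?j (fst p, snd p, y)) * indicator B y
      \<partial>(MX \<Otimes>\<^sub>M count_space A) \<partial>MY)"
    using XCY.nn_integral_snd[OF g] by (simp add: nn_integral_ref_measure[OF f])
  also have "\<dots> = (\<integral>\<^sup>+ y. ennreal (?q y) * indicator B y \<partial>MY)"
  proof (rule nn_integral_cong_AE)
    show "AE y in MY. (\<integral>\<^sup>+ p. ennreal (?j (fst p, snd p, y)) * indicator B y \<partial>(MX \<Otimes>\<^sub>M count_space A)) =
        ennreal (?q y) * indicator B y"
      using AE_integrable_joint_density[OF \<pi>] AE_space
    proof eventually_elim
      case (elim y)
      then have i: "integrable (MX \<Otimes>\<^sub>M count_space A) (\<lambda>p. ?j (fst p, snd p, y))"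
        by (simp add: case_prod_beta')
      have nn: "AE p in MX \<Otimes>\<^sub>M count_space A. 0 \<le> ?j (fst p, snd p, y)"
        using elim joint_density_nonneg[OF \<pi>]
        by (intro AE_I2) (auto simp: space_pair_measure space_ref_measure space_MY)
      show ?case
        using nn_integral_eq_integral[OF i nn] i
        by (subst nn_integral_multc) (auto simp: outcome_density_def case_prod_beta')
    qed
  qed
  also have "\<dots> = emeasure (density MY (\<lambda>y. ennreal (?q y))) B" by (simp add: emeasure_density)
  finally show "emeasure (distr (joint_law MX A MY pX pY \<pi>) MY outc) B = \<dots>" .
qed simp

text \<open>These make the quotients behave as densities despite division by zero. Where
  \<open>\<pi>b\<close> vanishes, support forces \<open>\<pi>s\<close> to vanish too. The same
  passes to outcomes: if the behaviour marginal is 0 at \<open>y\<close>, its nonnegative joint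
  density is 0 for almost all \<open>(x, a)\<close>, hence so is the target one, being its multiple
  by \<open>\<rho>\<close>.\<close>

lemma
  assumes \<pi>b: "policy MX A \<pi>b" and \<pi>s: "policy MX A \<pi>s"
    and support: "\<forall>x\<in>space MX. \<forall>a\<in>A. \<pi>s a x > 0 \<longrightarrow> \<pi>b a x > 0"
  shows policy_eq_rho_mult: "x \<in> space MX \<Longrightarrow> a \<in> A \<Longrightarrow> \<pi>b a x * rho \<pi>s \<pi>b a x = \<pi>s a x"
    and joint_density_mult_rho: "z \<in> space (ref_measure MX A MY) \<Longrightarrow>
      joint_density pX pY \<pi>b z * rho \<pi>s \<pi>b (act z) (ctx z) = joint_density pX pY \<pi>s z"
    and marginal_ratio_mult: "AE y in MY. outcome_density MX A pX pY \<pi>b y *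
      marginal_ratio MX A pX pY \<pi>s \<pi>b y = outcome_density MX A pX pY \<pi>s y"
proof -
  have *: "\<pi>b a x * rho \<pi>s \<pi>b a x = \<pi>s a x" if "x \<in> space MX" "a \<in> A" for x a
    using that support \<pi>b \<pi>s by (fastforce simp: rho_def policy_def)
  then show "x \<in> space MX \<Longrightarrow> a \<in> A \<Longrightarrow> \<pi>b a x * rho \<pi>s \<pi>b a x = \<pi>s a x" .
  have **: "joint_density pX pY \<pi>b z * rho \<pi>s \<pi>b (act z) (ctx z) = joint_density pX pY \<pi>s z"
    if "z \<in> space (ref_measure MX A MY)" for z
    using that *[of "ctx z" "act z"]
    by (auto simp: joint_density_def space_ref_measure)
  then show "z \<in> space (ref_measure MX A MY) \<Longrightarrow>
      joint_density pX pY \<pi>b z * rho \<pi>s \<pi>b (act z) (ctx z) = joint_density pX pY \<pi>s z" .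
  let ?q = "outcome_density MX A pX pY"
  show "AE y in MY. ?q \<pi>b y * marginal_ratio MX A pX pY \<pi>s \<pi>b y = ?q \<pi>s y"
    using AE_integrable_joint_density[OF \<pi>b] AE_space
  proof eventually_elim
    case (elim y)
    show ?case
    proof (cases "?q \<pi>b y = 0")
      case True
      have "AE p in MX \<Otimes>\<^sub>M count_space A. 0 \<le> (case p of (x, a) \<Rightarrow> joint_density pX pY \<pi>b (x, a, y))"
        using elim joint_density_nonneg[OF \<pi>b]
        by (intro AE_I2) (auto simp: space_pair_measure space_ref_measure space_MY)
      then have "AE p in MX \<Otimes>\<^sub>M count_space A. (case p of (x, a) \<Rightarrow> joint_density pX pY \<pi>b (x, a, y)) = 0"
        using True integral_nonneg_eq_0_iff_AE[OF elim(1)] by (simp add: outcome_density_def)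
      then have "AE p in MX \<Otimes>\<^sub>M count_space A. (case p of (x, a) \<Rightarrow> joint_density pX pY \<pi>s (x, a, y)) = 0"
        using AE_space
      proof eventually_elim
        case (elim p)
        then show ?case
          using **[of "(fst p, snd p, y)"] \<open>y \<in> space MY\<close>
          by (auto simp: space_pair_measure space_ref_measure space_MY)
      qed
      then have "?q \<pi>s y = 0" unfolding outcome_density_def by (rule integral_eq_zero_AE)
      then show ?thesis using True by simp
    qed (simp add: marginal_ratio_def)
  qed
qed

text \<open>Change of measure in both directions: on an event about \<open>Y\<close>, weighting by
  \<open>\<rho>\<close> turns the behaviour law into the target law, whose outcome marginal is the
  behaviour marginal weighted by \<open>w\<close>.\<close>

lemma real_cond_exp_rho_outc:
  fixes \<pi>b \<pi>s :: "'a \<Rightarrow> 'x \<Rightarrow> real"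
  defines "P \<equiv> joint_law MX A MY pX pY \<pi>b"
  assumes \<pi>b: "policy MX A \<pi>b" and \<pi>s: "policy MX A \<pi>s"
    and support: "\<forall>x\<in>space MX. \<forall>a\<in>A. \<pi>s a x > 0 \<longrightarrow> \<pi>b a x > 0"
  shows "AE z in P. real_cond_exp P (vimage_algebra (space P) outc MY)
      (\<lambda>z. rho \<pi>s \<pi>b (act z) (ctx z)) z = marginal_ratio MX A pX pY \<pi>s \<pi>b (outc z)"
proof -
  interpret P: prob_space P unfolding P_def by (rule prob_space_joint_law[OF \<pi>b])
  have outcP: "outc \<in> measurable P MY" by (simp add: P_def)
  let ?F = "vimage_algebra (space P) outc MY"
  let ?r = "\<lambda>z. rho \<pi>s \<pi>b (act z) (ctx z)" and ?w = "marginal_ratio MX A pX pY \<pi>s \<pi>b"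
  let ?qb = "outcome_density MX A pX pY \<pi>b" and ?qs = "outcome_density MX A pX pY \<pi>s"
  have F: "subalgebra P ?F" by (rule subalgebra_vimage_algebra[OF outcP])
  interpret F: finite_measure_subalgebra P ?F by standard (rule F)
  note [measurable] = measurable_joint_density[OF \<pi>b] measurable_joint_density[OF \<pi>s]
    borel_measurable_integrable[OF integrable_outcome_density[OF \<pi>b]]
    borel_measurable_integrable[OF integrable_outcome_density[OF \<pi>s]]
    measurable_compose[OF measurable_ctx_act measurable_policy[OF \<pi>b], simplified]
    measurable_compose[OF measurable_ctx_act measurable_policy[OF \<pi>s], simplified]
  have r[measurable]: "?r \<in> borel_measurable (ref_measure MX A MY)" unfolding rho_def by measurable
  have w[measurable]: "?w \<in> borel_measurable MY" unfolding marginal_ratio_def[abs_def] by measurable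
  have jnn: "AE z in ref_measure MX A MY. 0 \<le> joint_density pX pY \<pi>b z"
      "AE z in ref_measure MX A MY. 0 \<le> joint_density pX pY \<pi>s z"
    by (auto intro!: AE_I2 joint_density_nonneg[OF \<pi>b] joint_density_nonneg[OF \<pi>s])
  have qnn: "AE y in MY. 0 \<le> ?qb y" "AE y in MY. 0 \<le> ?qs y"
    by (auto intro!: AE_I2 outcome_density_nonneg[OF \<pi>b] outcome_density_nonneg[OF \<pi>s])
  have wq: "AE y in MY. ?qb y * ?w y = ?qs y" by (rule marginal_ratio_mult[OF \<pi>b \<pi>s support])
  have "integrable MY (\<lambda>y. ?qb y * ?w y)"
    by (rule integrable_cong_AE_imp[OF integrable_outcome_density[OF \<pi>s]]) (use wq in auto)
  then have "integrable (distr P MY outc) ?w"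
    unfolding P_def distr_outc_joint_law[OF \<pi>b] using qnn by (subst integrable_density) auto
  then have wi: "integrable P (\<lambda>z. ?w (outc z))" by (rule integrable_distr[OF outcP])
  have ri: "integrable P ?r"
    unfolding P_def joint_law_def
    using integrable_joint_density[OF \<pi>s] jnn joint_density_mult_rho[OF \<pi>b \<pi>s support]
    by (subst integrable_density) (auto cong: Bochner_Integration.integrable_cong)
  show ?thesis
  proof (rule F.real_cond_exp_charact[OF _ ri wi])
    show "(\<lambda>z. ?w (outc z)) \<in> borel_measurable ?F"
      by (rule measurable_compose[OF measurable_vimage_algebra1 w]) (use measurable_space[OF outcP] in auto)
    fix B assume "B \<in> sets ?F"
    then obtain B' where B': "B' \<in> sets MY" "B = outc -` B' \<inter> space P"
      using sets_vimage_algebra2[of outc "space P" MY] measurable_space[OF outcP] by auto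
    note [measurable] = B'(1)
    let ?I = "\<lambda>z. indicator B' (outc z) :: real"
    have eq: "indicator B z = ?I z" if "z \<in> space P" for z
      using that B'(2) by (simp add: indicator_def)
    have "(\<integral>z\<in>B. ?r z \<partial>P) = (\<integral>z. ?I z * ?r z \<partial>P)"
      unfolding set_lebesgue_integral_def by (rule Bochner_Integration.integral_cong) (auto simp: eq)
    also have "\<dots> = (\<integral>z. joint_density pX pY \<pi>b z * (?I z * ?r z) \<partial>ref_measure MX A MY)"
      unfolding P_def joint_law_def using jnn by (subst integral_density) auto
    also have "\<dots> = (\<integral>z. joint_density pX pY \<pi>s z * ?I z \<partial>ref_measure MX A MY)"
      by (rule Bochner_Integration.integral_cong)
        (auto simp flip: joint_density_mult_rho[OF \<pi>b \<pi>s support])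
    also have "\<dots> = (\<integral>z. ?I z \<partial>joint_law MX A MY pX pY \<pi>s)"
      unfolding joint_law_def using jnn by (subst integral_density) auto
    also have "\<dots> = (\<integral>y. indicator B' y \<partial>distr (joint_law MX A MY pX pY \<pi>s) MY outc)"
      by (subst integral_distr) auto
    also have "\<dots> = (\<integral>y. ?qs y * indicator B' y \<partial>MY)"
      unfolding distr_outc_joint_law[OF \<pi>s] using qnn by (subst integral_density) auto
    \<comment> \<open>Only the outcome matters by now, so the return to the behaviour law costs the
      weight \<open>w\<close> instead of \<open>\<rho>\<close>.\<close>
    also have "\<dots> = (\<integral>y. ?qb y * (indicator B' y * ?w y) \<partial>MY)"
      by (rule integral_cong_AE) (use wq in \<open>auto elim!: eventually_mono\<close>)
    also have "\<dots> = (\<integral>y. indicator B' y * ?w y \<partial>distr P MY outc)"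
      unfolding P_def distr_outc_joint_law[OF \<pi>b] using qnn by (subst integral_density) auto
    also have "\<dots> = (\<integral>z. ?I z * ?w (outc z) \<partial>P)"
      using outcP by (subst integral_distr) auto
    also have "\<dots> = (\<integral>z\<in>B. ?w (outc z) \<partial>P)"
      unfolding set_lebesgue_integral_def by (rule Bochner_Integration.integral_cong) (auto simp: eq)
    finally show "(\<integral>z\<in>B. ?r z \<partial>P) = (\<integral>z\<in>B. ?w (outc z) \<partial>P)" .
  qed
qed

end

section \<open>Sample means of i.i.d. data and expected conditional variances\<close>

text \<open>A function of \<open>V\<close> carries no more information than \<open>V\<close>; used
  to place the sigma-algebra of the context inside that of context and action.\<close>

lemma subalgebra_vimage_algebra_compose:
  assumes "V \<in> X \<rightarrow> space N" "g \<in> measurable N N'"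
  shows "subalgebra (vimage_algebra X V N) (vimage_algebra X (\<lambda>z. g (V z)) N')"
  using subalgebra_vimage_algebra[OF measurable_compose[OF measurable_vimage_algebra1 assms(2)], OF assms(1)]
  by simp

context prob_space
begin

text \<open>Transfers moments between the data space and a single draw. The first part turns the
  finite variance of an estimator into that of its summand; the second produces the factor
  \<open>1 / n\<close>.\<close>

lemma
  fixes g :: "'z \<Rightarrow> real"
  assumes n: "n > 0" and ind: "indep_vars (\<lambda>_. N) Z {..<n}"
    and Z: "\<And>i. i < n \<Longrightarrow> distr M N (Z i) = P" and g[measurable]: "g \<in> borel_measurable N"
  shows square_integrable_iid_meanD:
      "integrable M (\<lambda>\<omega>. (1 / real n * (\<Sum>i<n. g (Z i \<omega>)))\<^sup>2) \<Longrightarrow> integrable P (\<lambda>z. (g z)\<^sup>2)"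
    and variance_iid_mean:
      "integrable P (\<lambda>z. (g z)\<^sup>2) \<Longrightarrow>
        variance (\<lambda>\<omega>. 1 / real n * (\<Sum>i<n. g (Z i \<omega>))) = 1 / real n * (\<integral>z. (g z - (\<integral>z. g z \<partial>P))\<^sup>2 \<partial>P)"
proof -
  have Zm: "Z i \<in> measurable M N" if "i < n" for i
    using ind that by (auto simp: indep_vars_def)
  have indg: "indep_vars (\<lambda>_. borel) (\<lambda>i \<omega>. g (Z i \<omega>)) {..<n}"
    by (rule indep_vars_compose2[OF ind]) simp
  have int: "integrable M (\<lambda>\<omega>. (g (Z i \<omega>))\<^sup>2) \<longleftrightarrow> integrable P (\<lambda>z. (g z)\<^sup>2)" if "i < n" for i
    unfolding Z[OF that, symmetric] using Zm[OF that] by (subst integrable_distr_eq) auto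
  have var: "variance (\<lambda>\<omega>. g (Z i \<omega>)) = (\<integral>z. (g z - (\<integral>z. g z \<partial>P))\<^sup>2 \<partial>P)" if "i < n" for i
    unfolding Z[OF that, symmetric] using Zm[OF that] by (simp add: integral_distr)
  show "integrable P (\<lambda>z. (g z)\<^sup>2)" if "integrable M (\<lambda>\<omega>. (1 / real n * (\<Sum>i<n. g (Z i \<omega>)))\<^sup>2)"
  proof -
    have "integrable M (\<lambda>\<omega>. (real n)\<^sup>2 * (1 / real n * (\<Sum>i<n. g (Z i \<omega>)))\<^sup>2)"
      using that by (rule integrable_mult_right)
    then have "integrable M (\<lambda>\<omega>. (\<Sum>i<n. g (Z i \<omega>))\<^sup>2)"
      using n by (simp add: power_mult_distrib power_divide)
    then have "integrable M (\<lambda>\<omega>. (g (Z 0 \<omega>))\<^sup>2)"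
      using n by (intro indep_vars_square_integrable_sumD[OF _ _ indg]) auto
    then show ?thesis using int n by blast
  qed
  assume g2: "integrable P (\<lambda>z. (g z)\<^sup>2)"
  have "variance (\<lambda>\<omega>. \<Sum>i<n. g (Z i \<omega>)) = (\<Sum>i<n. variance (\<lambda>\<omega>. g (Z i \<omega>)))"
    using indep_vars_variance_sum[OF _ indg] int g2 by simp
  also have "\<dots> = real n * (\<integral>z. (g z - (\<integral>z. g z \<partial>P))\<^sup>2 \<partial>P)"
    by (simp add: var)
  finally have s: "variance (\<lambda>\<omega>. \<Sum>i<n. g (Z i \<omega>)) = real n * (\<integral>z. (g z - (\<integral>z. g z \<partial>P))\<^sup>2 \<partial>P)" .
  have "variance (\<lambda>\<omega>. 1 / real n * (\<Sum>i<n. g (Z i \<omega>))) =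
      expectation (\<lambda>\<omega>. (1 / real n)\<^sup>2 * ((\<Sum>i<n. g (Z i \<omega>)) - expectation (\<lambda>\<omega>. \<Sum>i<n. g (Z i \<omega>)))\<^sup>2)"
    unfolding integral_mult_right_zero right_diff_distrib[symmetric] power_mult_distrib ..
  also have "\<dots> = (1 / real n)\<^sup>2 * variance (\<lambda>\<omega>. \<Sum>i<n. g (Z i \<omega>))"
    by (rule integral_mult_right_zero)
  finally show "variance (\<lambda>\<omega>. 1 / real n * (\<Sum>i<n. g (Z i \<omega>))) = 1 / real n * (\<integral>z. (g z - (\<integral>z. g z \<partial>P))\<^sup>2 \<partial>P)"
    unfolding s using n by (simp add: power2_eq_square)
qed

text \<open>Expectation undoes the outer conditional expectation in \<open>cond_var\<close>.
  Integrability is recorded because the bound takes the expectation of a difference of two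
  conditional variances, which has to be split.\<close>

lemma
  assumes V: "V \<in> measurable M N" and f[measurable]: "f \<in> borel_measurable M"
    and f2: "integrable M (\<lambda>z. (f z)\<^sup>2)"
  shows integrable_cond_var: "integrable M (cond_var M N V f)"
    and expectation_cond_var: "expectation (cond_var M N V f) =
      (\<integral>z. (f z - real_cond_exp M (vimage_algebra (space M) V N) f z)\<^sup>2 \<partial>M)"
proof -
  let ?F = "vimage_algebra (space M) V N"
  interpret F: finite_measure_subalgebra M ?F
    by standard (rule subalgebra_vimage_algebra[OF V])
  have "integrable M (\<lambda>z. (f z - real_cond_exp M ?F f z)\<^sup>2)"
    by (rule square_integrable_diff) (use F.square_integrable_real_cond_exp[OF f f2] f2 in auto)
  from F.real_cond_exp_int[OF this]
  show "integrable M (cond_var M N V f)"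
    "expectation (cond_var M N V f) = (\<integral>z. (f z - real_cond_exp M ?F f z)\<^sup>2 \<partial>M)"
    by (simp_all add: cond_var_def cond_expect_def)
qed

end

section \<open>Comparison of the two estimators\<close>

theorem proposition3p4:
  fixes MX :: "'x measure" and A :: "'a set" and S :: "real set" and MY :: "real measure"
    and pX :: "'x \<Rightarrow> real" and pY :: "real \<Rightarrow> 'x \<Rightarrow> 'a \<Rightarrow> real"
    and \<pi>b \<pi>s \<mu>hat :: "'a \<Rightarrow> 'x \<Rightarrow> real"
    and \<Omega> :: "'w measure" and Z :: "nat \<Rightarrow> 'w \<Rightarrow> 'x \<times> 'a \<times> real" and n :: nat
  defines "P \<equiv> joint_law MX A MY pX pY \<pi>b"
    and "\<rho> \<equiv> rho \<pi>s \<pi>b"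
    and "w \<equiv> marginal_ratio MX A pX pY \<pi>s \<pi>b"
  defines "\<mu> \<equiv> outcome_mean MX A P"
    and "DR \<equiv> (\<lambda>\<omega>. theta_DR n A \<pi>s \<pi>b \<mu>hat (\<lambda>i. Z i \<omega>))"
    and "MR \<equiv> (\<lambda>\<omega>. theta_MR n w (\<lambda>i. Z i \<omega>))"
  assumes bandit: "contextual_bandit MX A S MY pX pY"
    and behaviour_policy: "policy MX A \<pi>b"
    and target_policy: "policy MX A \<pi>s"
    and support: "\<forall>x\<in>space MX. \<forall>a\<in>A. \<pi>s a x > 0 \<longrightarrow> \<pi>b a x > 0"
    and outcome_model: "(\<lambda>(x, a). \<mu>hat a x) \<in> borel_measurable (MX \<Otimes>\<^sub>M count_space A)"
    and n_pos: "n > 0"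
    and prob_space: "prob_space \<Omega>"
    and independent: "prob_space.indep_vars \<Omega> (\<lambda>_. ref_measure MX A MY) Z {..<n}"
    and identically_distributed: "\<forall>i<n. distributed \<Omega> (ref_measure MX A MY) (Z i)
           (\<lambda>z. ennreal (joint_density pX pY \<pi>b z))"
    and finite_mean: "integrable P outc"
    and finite_model_mean: "AE x in density MX (\<lambda>x. ennreal (pX x)).
           (\<lambda>a. \<mu>hat a x * \<pi>s a x) summable_on A"
    and finite_variance: "integrable P (\<lambda>z. (\<rho> (act z) (ctx z) * outc z)\<^sup>2)"
    and finite_variance_DR: "integrable \<Omega> (\<lambda>\<omega>. (DR \<omega>)\<^sup>2)"
  shows "prob_space.variance \<Omega> DR - prob_space.variance \<Omega> MR \<ge>
     1 / real n * prob_space.expectation P (\<lambda>z.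
        cond_var P MY outc (\<lambda>z. \<rho> (act z) (ctx z) * outc z) z
        - cond_var P MX ctx (\<lambda>z. \<rho> (act z) (ctx z) * \<mu> z) z)"
proof -
  interpret contextual_bandit MX A S MY pX pY by (rule bandit)
  interpret C: sigma_finite_measure "count_space A" by (rule sigma_finite_count_space)
  interpret \<Omega>: prob_space \<Omega> by (rule prob_space)
  interpret P: prob_space P unfolding P_def by (rule prob_space_joint_law[OF behaviour_policy])
  let ?R = "ref_measure MX A MY" and ?XA = "MX \<Otimes>\<^sub>M count_space A"
  have MP: "measurable P N = measurable ?R N" for N by (simp add: P_def)
  define h where "h x = (\<Sum>\<^sub>\<infinity>a\<in>A. \<mu>hat a x * \<pi>s a x)" for x
  define d where "d x a = \<rho> a x * \<mu>hat a x - h x" for x a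
  define U where "U z = \<rho> (act z) (ctx z) * outc z" for z
  define D where "D z = d (ctx z) (act z)" for z
  define V where "V z = \<rho> (act z) (ctx z) * \<mu> z" for z
  define W where "W z = w (outc z) * outc z" for z :: "'x \<times> 'a \<times> real"
  let ?FX = "vimage_algebra (space P) ctx MX"
  let ?FXA = "vimage_algebra (space P) (\<lambda>z. (ctx z, act z)) ?XA"
  let ?FY = "vimage_algebra (space P) outc MY"
  have ctxP: "ctx \<in> measurable P MX" and xaP: "(\<lambda>z. (ctx z, act z)) \<in> measurable P ?XA"
    and outcP: "outc \<in> measurable P MY"
    unfolding MP by measurable
  have FXA: "subalgebra P ?FXA" by (rule subalgebra_vimage_algebra[OF xaP])
  have FY: "subalgebra P ?FY" by (rule subalgebra_vimage_algebra[OF outcP])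
  have FX: "subalgebra ?FXA ?FX"
    using subalgebra_vimage_algebra_compose[of "\<lambda>z. (ctx z, act z)" "space P" ?XA fst MX] measurable_space[OF xaP]
    by auto
  interpret FXA: finite_measure_subalgebra P ?FXA by standard (rule FXA)
  interpret FY: finite_measure_subalgebra P ?FY by standard (rule FY)
  have xaF: "(\<lambda>z. (ctx z, act z)) \<in> measurable ?FXA ?XA"
    by (rule measurable_vimage_algebra1) (use measurable_space[OF xaP] in auto)
  have yF: "outc \<in> measurable ?FY MY"
    by (rule measurable_vimage_algebra1) (use measurable_space[OF outcP] in auto)

  note [measurable] = measurable_policy[OF behaviour_policy] measurable_policy[OF target_policy]
    outcome_model[unfolded case_prod_beta']
    borel_measurable_integrable[OF integrable_outcome_density[OF behaviour_policy]]
    borel_measurable_integrable[OF integrable_outcome_density[OF target_policy]]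
  have rho_m[measurable]: "(\<lambda>p. \<rho> (snd p) (fst p)) \<in> borel_measurable ?XA"
    unfolding \<rho>_def rho_def by measurable
  have w_m[measurable]: "w \<in> borel_measurable MY"
    unfolding w_def marginal_ratio_def[abs_def] by measurable
  \<comment> \<open>Measurability of the infinite sum \<open>h\<close> is obtained from that of a
    parametrised integral.\<close>
  have "(\<lambda>x. \<integral>a. \<mu>hat a x * \<pi>s a x \<partial>count_space A) \<in> borel_measurable MX"
    by (rule C.borel_measurable_lebesgue_integral) (simp add: case_prod_beta')
  then have h_m[measurable]: "h \<in> borel_measurable MX"
    by (simp add: h_def[abs_def] integral_count_space_eq_infsum)
  have d_m[measurable]: "(\<lambda>p. d (fst p) (snd p)) \<in> borel_measurable ?XA"
    unfolding d_def by measurable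
  have rho_FXA: "(\<lambda>z. \<rho> (act z) (ctx z)) \<in> borel_measurable ?FXA"
    using measurable_compose[OF xaF rho_m] by simp
  have D_FXA: "D \<in> borel_measurable ?FXA"
    using measurable_compose[OF xaF d_m] by (simp add: D_def[abs_def])
  have rho_P[measurable]: "(\<lambda>z. \<rho> (act z) (ctx z)) \<in> borel_measurable P"
    by (rule measurable_from_subalg[OF FXA rho_FXA])
  have D_P[measurable]: "D \<in> borel_measurable P"
    by (rule measurable_from_subalg[OF FXA D_FXA])
  have outc_P[measurable]: "outc \<in> borel_measurable P"
    using measurable_compose[OF outcP measurable_ident_MY] by simp
  have U_P[measurable]: "U \<in> borel_measurable P" unfolding U_def by measurable
  have W_P[measurable]: "W \<in> borel_measurable P"
    unfolding W_def using measurable_compose[OF outcP w_m] by measurable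
  have V_P[measurable]: "V \<in> borel_measurable P"
    unfolding V_def \<mu>_def outcome_mean_def cond_expect_def by measurable
  have U2: "integrable P (\<lambda>z. (U z)\<^sup>2)" using finite_variance by (simp add: U_def)
  have Ui: "integrable P U" by (rule P.square_integrable_imp_integrable[OF U_P U2])

  have DR: "DR = (\<lambda>\<omega>. 1 / real n * (\<Sum>i<n. U (Z i \<omega>) - D (Z i \<omega>)))"
    unfolding DR_def theta_DR_def U_def D_def d_def h_def \<rho>_def
    by (simp add: sum.distrib[symmetric] distrib_left[symmetric] algebra_simps
        flip: sum.distrib sum_subtractf add_divide_distrib)
  have MR: "MR = (\<lambda>\<omega>. 1 / real n * (\<Sum>i<n. W (Z i \<omega>)))"
    unfolding MR_def theta_MR_def W_def ..
  have Z: "distr \<Omega> ?R (Z i) = P" if "i < n" for i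
    using identically_distributed that by (simp add: distributed_def P_def joint_law_def)
  have UD_R: "(\<lambda>z. U z - D z) \<in> borel_measurable ?R" and W_R: "W \<in> borel_measurable ?R"
    unfolding MP[symmetric] by measurable
  have UD2: "integrable P (\<lambda>z. (U z - D z)\<^sup>2)"
    by (rule \<Omega>.square_integrable_iid_meanD[OF n_pos independent Z UD_R])
      (use finite_variance_DR in \<open>simp_all add: DR\<close>)
  \<comment> \<open>\<open>D\<close> inherits square integrability from the estimator and from
    \<open>U\<close>; no moment of \<open>\<mu>hat\<close> is assumed.\<close>
  have "integrable P (\<lambda>z. (U z - (U z - D z))\<^sup>2)"
    by (rule square_integrable_diff) (use U2 UD2 in auto)
  then have D2: "integrable P (\<lambda>z. (D z)\<^sup>2)" by simp

  have D0: "AE z in P. real_cond_exp P ?FX D z = 0"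
    unfolding D_def[abs_def] P_def
  proof (rule real_cond_exp_ctx_eq_0[OF behaviour_policy d_m])
    show "integrable (joint_law MX A MY pX pY \<pi>b) (\<lambda>z. d (ctx z) (act z))"
      using P.square_integrable_imp_integrable[OF D_P D2] by (simp add: P_def D_def[abs_def])
    show "AE x in density MX (\<lambda>x. ennreal (pX x)). (\<integral>a. \<pi>b a x * d x a \<partial>count_space A) = 0"
      using finite_model_mean AE_space
    proof eventually_elim
      case (elim x)
      then have x: "x \<in> space MX" by simp
      have i: "integrable (count_space A) (\<lambda>a. \<mu>hat a x * \<pi>s a x)"
        using elim by (simp add: integrable_count_space_iff_summable_on)
      \<comment> \<open>Importance weighting turns the behaviour average of
        \<open>\<rho> \<mu>hat\<close> into the target average \<open>h x\<close>, and
        \<open>\<pi>b\<close> sums to 1, so the two terms cancel.\<close>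
      have "(\<integral>a. \<pi>b a x * d x a \<partial>count_space A) = (\<integral>a. \<mu>hat a x * \<pi>s a x - h x * \<pi>b a x \<partial>count_space A)"
      proof (rule Bochner_Integration.integral_cong)
        fix a assume "a \<in> space (count_space A)"
        then have rho: "\<pi>b a x * \<rho> a x = \<pi>s a x"
          unfolding \<rho>_def using policy_eq_rho_mult[OF behaviour_policy target_policy support x] by simp
        then show "\<pi>b a x * d x a = \<mu>hat a x * \<pi>s a x - h x * \<pi>b a x"
          by (simp add: d_def algebra_simps flip: rho)
      qed simp
      also have "\<dots> = h x - h x * 1"
        using i integrable_policy[OF behaviour_policy x]
        by (simp add: h_def flip: integral_count_space_eq_infsum)
      finally show ?case by simp
    qed
  qed

  \<comment> \<open>The weight \<open>\<rho>\<close> is a function of context and action and is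
    pulled out; \<open>Y\<close> is averaged to \<open>\<mu>\<close>.\<close>
  have VU: "AE z in P. real_cond_exp P ?FXA U z = V z"
    using FXA.real_cond_exp_mult[OF rho_FXA outc_P] Ui
    by (simp add: U_def[abs_def] V_def[abs_def] \<mu>_def outcome_mean_def cond_expect_def)
  have outcF: "outc \<in> borel_measurable ?FY"
    using measurable_compose[OF yF measurable_ident_MY] by simp
  \<comment> \<open>Given \<open>Y\<close> the roles swap: now \<open>Y\<close> is pulled out and
    \<open>\<rho>\<close> is averaged to \<open>w(Y)\<close>.\<close>
  have "AE z in P. real_cond_exp P ?FY (\<lambda>z. outc z * \<rho> (act z) (ctx z)) z =
      outc z * real_cond_exp P ?FY (\<lambda>z. \<rho> (act z) (ctx z)) z"
    by (rule FY.real_cond_exp_mult[OF outcF rho_P]) (use Ui in \<open>simp add: U_def[abs_def] mult.commute\<close>)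
  moreover have "AE z in P. real_cond_exp P ?FY (\<lambda>z. \<rho> (act z) (ctx z)) z = w (outc z)"
    unfolding P_def \<rho>_def w_def
    by (rule real_cond_exp_rho_outc[OF behaviour_policy target_policy support])
  ultimately have WU: "AE z in P. real_cond_exp P ?FY U z = W z"
    by eventually_elim (simp add: U_def[abs_def] W_def mult.commute)

  note CV = P.variance_diff_control_variate_ge[OF FXA FX U_P U2 D_FXA D2 D0 V_P VU]
  note TV = P.variance_real_cond_exp[OF FY U_P U2 W_P WU]
  have varDR: "\<Omega>.variance DR = 1 / real n * P.variance (\<lambda>z. U z - D z)"
    unfolding DR by (rule \<Omega>.variance_iid_mean[OF n_pos independent Z UD_R UD2])
  have varMR: "\<Omega>.variance MR = 1 / real n * P.variance W"
    unfolding MR by (rule \<Omega>.variance_iid_mean[OF n_pos independent Z W_R TV(2)])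
  have "P.expectation (\<lambda>z. cond_var P MY outc U z - cond_var P MX ctx V z) =
      (\<integral>z. (U z - real_cond_exp P ?FY U z)\<^sup>2 \<partial>P) - (\<integral>z. (V z - real_cond_exp P ?FX V z)\<^sup>2 \<partial>P)"
    using P.integrable_cond_var[OF outcP U_P U2] P.expectation_cond_var[OF outcP U_P U2]
      P.integrable_cond_var[OF ctxP V_P CV(2)] P.expectation_cond_var[OF ctxP V_P CV(2)] by simp
  \<comment> \<open>The variance of \<open>U\<close> occurs in both bounds and cancels.\<close>
  also have "\<dots> \<le> P.variance (\<lambda>z. U z - D z) - P.variance W"
    using CV(1) TV(1) by linarith
  finally have "1 / real n * P.expectation (\<lambda>z. cond_var P MY outc U z - cond_var P MX ctx V z) \<le>
      1 / real n * (P.variance (\<lambda>z. U z - D z) - P.variance W)"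
    by (intro mult_left_mono) auto
  also have "\<dots> = \<Omega>.variance DR - \<Omega>.variance MR"
    by (simp only: varDR varMR right_diff_distrib)
  finally show ?thesis by (simp add: U_def[abs_def] V_def[abs_def])
qed

end
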